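(* Let $P_n$ be a path on $n$ vertices with edges $e_1,\dots,e_{n-1}$ in order along the path, all of unit length $\ell=1$, and let $\varphi(x)=x/\alpha-\beta$ with $\alpha,\beta\ge1$. Consider the algorithm Greedy$(P_n,\alpha,\beta)$ which starts with $C:=\emptyset$ and, for $i=1,2,\dots,n-1$, adds $e_i$ to $C$ if and only if $|C|+1\le(1-1/\alpha)i+\beta$. The set $C$ computed by this algorithm is an optimal solution of the problem Contraction on the instance $(P_n,\ell,\varphi)$, and it is computed in time $O(n)$.
   Context: For a graph $G=(V,E)$ with edge lengths $\ell\colon E\to\mathbb{R}_{>0}$ and $C\subseteq E$: $\ell_C$ is the length function equal to $0$ on $C$ and $\ell$ elsewhere; $\mathrm{dist}_\ell$ is shortest-path distance. $C$ is a $\varphi$-contraction if $\mathrm{dist}_{\ell_C}(u,v)\ge\varphi(\mathrm{dist}_\ell(u,v))$ for all $u,v\in V$. $G/C$ denotes the simple graph obtained by contracting $C$, deleting loops and keeping one (shortest) edge among parallel edges; $\Delta(C)$ is the number of deleted loops and parallel edges and $\Phi(C)=|C|+\Delta(C)=m(G)-m(G/C)$. The problem Contraction, on input $(G,\ell,\varphi)$ with $\varphi$ non-decreasing, asks for a $\varphi$-contraction $C$ maximizing $\Phi(C)$ (an optimal solution). On a tree $\Phi(C)=|C|$. *)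

theory Defs
  imports Complex_Main
begin

section \<open>Contractions of graphs with edge lengths\<close>

record 'a graph =
  verts :: "'a set"
  edges :: "'a set set"

definition simple_graph :: "'a graph \<Rightarrow> bool" where
  "simple_graph G \<longleftrightarrow> finite (verts G) \<and> (\<forall>e\<in>edges G. e \<subseteq> verts G \<and> card e = 2)"

definition paths :: "'a graph \<Rightarrow> 'a \<Rightarrow> 'a \<Rightarrow> 'a list set" where
  "paths G u v = {p. p \<noteq> [] \<and> hd p = u \<and> last p = v \<and> distinct p \<and> set p \<subseteq> verts G
     \<and> successively (\<lambda>x y. {x, y} \<in> edges G) p}"

fun path_length :: "('a set \<Rightarrow> real) \<Rightarrow> 'a list \<Rightarrow> real" where
  "path_length l (x # y # p) = l {x, y} + path_length l (y # p)"
| "path_length l _ = 0"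

text \<open>Only meaningful for vertices in the same connected component: \<open>Inf {}\<close> is an unspecified
  real number.\<close>

definition graph_dist :: "'a graph \<Rightarrow> ('a set \<Rightarrow> real) \<Rightarrow> 'a \<Rightarrow> 'a \<Rightarrow> real" where
  "graph_dist G l u v = (INF p\<in>paths G u v. path_length l p)"

definition zero_on :: "'a set set \<Rightarrow> ('a set \<Rightarrow> real) \<Rightarrow> 'a set \<Rightarrow> real" where
  "zero_on C l e = (if e \<in> C then 0 else l e)"

text \<open>Vertices in different components are at distance \<open>\<infinity>\<close> both before and after the contraction,
  so the distance condition is void for them.\<close>

definition is_contraction ::
  "'a graph \<Rightarrow> ('a set \<Rightarrow> real) \<Rightarrow> (real \<Rightarrow> real) \<Rightarrow> 'a set set \<Rightarrow> bool" where
  "is_contraction G l \<phi> C \<longleftrightarrow> C \<subseteq> edges G \<and>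
     (\<forall>u\<in>verts G. \<forall>v\<in>verts G. paths G u v \<noteq> {} \<longrightarrow>
        graph_dist G (zero_on C l) u v \<ge> \<phi> (graph_dist G l u v))"

definition merged :: "'a set set \<Rightarrow> 'a \<Rightarrow> 'a set" where
  "merged C u = {v. (u, v) \<in> {(x, y). {x, y} \<in> C}\<^sup>*}"

text \<open>The vertices of \<open>G/C\<close> are the components of \<open>(V, C)\<close>. An edge \<open>e\<close> of \<open>G\<close> becomes
  \<open>merged C ` e\<close>, which is a singleton iff \<open>e\<close> turns into a loop. Which of several parallel edges
  is kept only matters for the lengths in \<open>G/C\<close>, and these do not enter \<open>\<Delta>\<close> and \<open>\<Phi>\<close>.\<close>

definition contract :: "'a graph \<Rightarrow> 'a set set \<Rightarrow> 'a set graph" where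
  "contract G C = \<lparr>verts = merged C ` verts G,
     edges = {merged C ` e | e. e \<in> edges G - C \<and> card (merged C ` e) = 2}\<rparr>"

definition deleted_loops :: "'a graph \<Rightarrow> 'a set set \<Rightarrow> nat" where
  "deleted_loops G C = card {e \<in> edges G - C. card (merged C ` e) = 1}"

definition deleted_parallels :: "'a graph \<Rightarrow> 'a set set \<Rightarrow> nat" where
  "deleted_parallels G C =
     (\<Sum>f\<in>edges (contract G C). card {e \<in> edges G - C. merged C ` e = f} - 1)"

definition Delta :: "'a graph \<Rightarrow> 'a set set \<Rightarrow> nat" where
  "Delta G C = deleted_loops G C + deleted_parallels G C"

definition Phi :: "'a graph \<Rightarrow> 'a set set \<Rightarrow> nat" where
  "Phi G C = card C + Delta G C"

lemma Phi_eq_edge_difference: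
  assumes G: "simple_graph G" and C: "C \<subseteq> edges G"
  shows "Phi G C = card (edges G) - card (edges (contract G C))"
proof -
  let ?m = "\<lambda>e. merged C ` e"
  let ?L = "{e \<in> edges G - C. card (?m e) = 1}"
  let ?N = "{e \<in> edges G - C. card (?m e) = 2}"
  let ?F = "edges (contract G C)"
  have F: "?F = ?m ` ?N" by (auto simp: contract_def)
  have "edges G \<subseteq> Pow (verts G)" using G by (auto simp: simple_graph_def)
  hence finE: "finite (edges G)"
    using G by (meson finite_Pow_iff finite_subset simple_graph_def)
  have split: "card (?m e) = 1 \<or> card (?m e) = 2" if "e \<in> edges G" for e
  proof -
    have e: "card e = 2" using G that by (auto simp: simple_graph_def)
    then have fin: "finite e" and ne: "e \<noteq> {}" by (auto intro: card_ge_0_finite)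
    have "card (?m e) \<le> 2" using card_image_le[OF fin] e by metis
    moreover have "card (?m e) \<noteq> 0" using fin ne by auto
    ultimately show ?thesis by linarith
  qed
  have un: "edges G - C = ?L \<union> ?N" using split by auto
  have "card (?L \<union> ?N) = card ?L + card ?N"
    by (rule card_Un_disjoint) (use finE in auto)
  with un have LN: "card (edges G - C) = card ?L + card ?N" by metis
  have fib: "{e \<in> ?N. ?m e = f} = {e \<in> edges G - C. ?m e = f}" if "f \<in> ?F" for f
    using that F by auto
  have pos: "card {e \<in> edges G - C. ?m e = f} \<ge> 1" if "f \<in> ?F" for f
  proof -
    have "{e \<in> edges G - C. ?m e = f} \<noteq> {}" using that F by auto
    thus ?thesis using finE by (simp add: Suc_le_eq card_gt_0_iff)
  qed
  have "card ?N = (\<Sum>f\<in>?F. card {e \<in> ?N. ?m e = f})"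
    using sum.image_gen[of ?N "\<lambda>_. 1 :: nat" ?m] finE F by simp
  also have "\<dots> = (\<Sum>f\<in>?F. card {e \<in> edges G - C. ?m e = f})"
    using fib by (intro sum.cong refl) simp
  also have "\<dots> = (\<Sum>f\<in>?F. (card {e \<in> edges G - C. ?m e = f} - 1) + 1)"
    using pos by (intro sum.cong refl) fastforce
  also have "\<dots> = deleted_parallels G C + card ?F"
    unfolding deleted_parallels_def sum.distrib by simp
  finally have "card ?N = deleted_parallels G C + card ?F" .
  moreover have "card (edges G) = card C + card (edges G - C)"
    using C finE by (metis card_Diff_subset card_mono finite_subset le_add_diff_inverse)
  ultimately show ?thesis
    using LN by (simp add: Phi_def Delta_def deleted_loops_def)
qed

text \<open>The problem Contraction: its admissible instances and their optimal solutions.\<close>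

definition contraction_instance ::
  "'a graph \<Rightarrow> ('a set \<Rightarrow> real) \<Rightarrow> (real \<Rightarrow> real) \<Rightarrow> bool" where
  "contraction_instance G l \<phi> \<longleftrightarrow> simple_graph G \<and> (\<forall>e\<in>edges G. l e > 0) \<and> mono_on {0..} \<phi>"

definition optimal_contraction ::
  "'a graph \<Rightarrow> ('a set \<Rightarrow> real) \<Rightarrow> (real \<Rightarrow> real) \<Rightarrow> 'a set set \<Rightarrow> bool" where
  "optimal_contraction G l \<phi> C \<longleftrightarrow> is_contraction G l \<phi> C \<and>
     (\<forall>C'. is_contraction G l \<phi> C' \<longrightarrow> Phi G C' \<le> Phi G C)"


section \<open>Paths and the greedy algorithm\<close>

definition path_edge :: "nat \<Rightarrow> nat set" where
  "path_edge i = {i, i + 1}"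

definition path_graph :: "nat \<Rightarrow> nat graph" where
  "path_graph n = \<lparr>verts = {1..n}, edges = path_edge ` {1..<n}\<rparr>"

lemma contraction_instance_path_graph:
  assumes "\<alpha> \<ge> 1"
  shows "contraction_instance (path_graph n) (\<lambda>_. 1) (\<lambda>x. x / \<alpha> - \<beta>)"
  using assms
  by (auto simp: contraction_instance_def simple_graph_def path_graph_def path_edge_def
      divide_right_mono intro!: mono_onI)

definition greedy :: "nat \<Rightarrow> real \<Rightarrow> real \<Rightarrow> nat set set" where
  "greedy n \<alpha> \<beta> =
     fold (\<lambda>i C. if real (card C) + 1 \<le> (1 - 1 / \<alpha>) * real i + \<beta>
                 then insert (path_edge i) C else C) [1..<n] {}"


section \<open>Running time\<close>

text \<open>A while language over the real RAM: variables hold real numbers, every constant, variable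
  access, arithmetic operation, comparison, assignment, branch and output operation takes one unit of
  time. The output is a list of numbers that is extended by \<open>Append\<close>. Programs contain only
  integer constants.\<close>

datatype aexp =
    Const int
  | Var string
  | Plus aexp aexp
  | Minus aexp aexp
  | Times aexp aexp
  | Divide aexp aexp

datatype bexp = Leq aexp aexp

datatype com =
    Assign string aexp
  | Append aexp
  | Seq com com
  | Cond bexp com com
  | Skip
  | While bexp com

type_synonym store = "string \<Rightarrow> real"

primrec aval :: "aexp \<Rightarrow> store \<Rightarrow> real" where
  "aval (Const k) s = real_of_int k"
| "aval (Var x) s = s x"
| "aval (Plus a b) s = aval a s + aval b s"
| "aval (Minus a b) s = aval a s - aval b s"
| "aval (Times a b) s = aval a s * aval b s"
| "aval (Divide a b) s = aval a s / aval b s"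

primrec acost :: "aexp \<Rightarrow> nat" where
  "acost (Const k) = 1"
| "acost (Var x) = 1"
| "acost (Plus a b) = 1 + acost a + acost b"
| "acost (Minus a b) = 1 + acost a + acost b"
| "acost (Times a b) = 1 + acost a + acost b"
| "acost (Divide a b) = 1 + acost a + acost b"

primrec bval :: "bexp \<Rightarrow> store \<Rightarrow> bool" where
  "bval (Leq a b) s \<longleftrightarrow> aval a s \<le> aval b s"

primrec bcost :: "bexp \<Rightarrow> nat" where
  "bcost (Leq a b) = 1 + acost a + acost b"

text \<open>\<open>exec c s out t s' out'\<close>: started in store \<open>s\<close> with output \<open>out\<close>, the program \<open>c\<close> terminates
  after \<open>t\<close> steps in store \<open>s'\<close> with output \<open>out'\<close>.\<close>

inductive exec :: "com \<Rightarrow> store \<Rightarrow> real list \<Rightarrow> nat \<Rightarrow> store \<Rightarrow> real list \<Rightarrow> bool" where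
  Assign: "exec (Assign x a) s out (1 + acost a) (s(x := aval a s)) out"
| Append: "exec (Append a) s out (1 + acost a) s (out @ [aval a s])"
| Seq: "exec c1 s out t1 s1 out1 \<Longrightarrow> exec c2 s1 out1 t2 s2 out2 \<Longrightarrow>
    exec (Seq c1 c2) s out (t1 + t2) s2 out2"
| CondTrue: "bval b s \<Longrightarrow> exec c1 s out t s' out' \<Longrightarrow>
    exec (Cond b c1 c2) s out (1 + bcost b + t) s' out'"
| CondFalse: "\<not> bval b s \<Longrightarrow> exec c2 s out t s' out' \<Longrightarrow>
    exec (Cond b c1 c2) s out (1 + bcost b + t) s' out'"
| Skip: "exec Skip s out 1 s out"
| WhileFalse: "\<not> bval b s \<Longrightarrow> exec (While b c) s out (1 + bcost b) s out"
| WhileTrue: "bval b s \<Longrightarrow> exec c s out t1 s1 out1 \<Longrightarrow> exec (While b c) s1 out1 t2 s2 out2 \<Longrightarrow>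
    exec (While b c) s out (1 + bcost b + t1 + t2) s2 out2"

inductive_cases AssignE: "exec (Assign x a) s out t s' out'"
inductive_cases AppendE: "exec (Append a) s out t s' out'"
inductive_cases SeqE: "exec (Seq c1 c2) s out t s' out'"
inductive_cases CondE: "exec (Cond b c1 c2) s out t s' out'"
inductive_cases SkipE: "exec Skip s out t s' out'"
inductive_cases WhileE: "exec (While b c) s out t s' out'"

lemma exec_deterministic:
  "exec c s out t s' out' \<Longrightarrow> exec c s out u s'' out'' \<Longrightarrow> u = t \<and> s'' = s' \<and> out'' = out'"
proof (induction arbitrary: u s'' out'' rule: exec.induct)
  case Assign
  then show ?case by (auto elim: AssignE)
next
  case Append
  then show ?case by (auto elim: AppendE)
next
  case (Seq c1 s out t1 s1 out1 c2 t2 s2 out2)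
  from Seq.prems show ?case by (rule SeqE) (use Seq.IH in metis)
next
  case (CondTrue b s c1 out t s' out' c2)
  from CondTrue.prems show ?case by (rule CondE) (use CondTrue.hyps in \<open>auto dest!: CondTrue.IH\<close>)
next
  case (CondFalse b s c2 out t s' out' c1)
  from CondFalse.prems show ?case by (rule CondE) (use CondFalse.hyps in \<open>auto dest!: CondFalse.IH\<close>)
next
  case Skip
  then show ?case by (auto elim: SkipE)
next
  case (WhileFalse b s c out)
  from WhileFalse.prems show ?case by (rule WhileE) (use WhileFalse.hyps in \<open>auto\<close>)
next
  case (WhileTrue b s c out t1 s1 out1 t2 s2 out2)
  from WhileTrue.prems show ?case by (rule WhileE) (use WhileTrue.hyps in \<open>auto dest!: WhileTrue.IH\<close>)
qed

text \<open>The variable \<open>k\<close> holds \<open>|C|\<close>; the edge \<open>e\<^sub>i\<close> is added to \<open>C\<close> by appending its index \<open>i\<close>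
  to the output.\<close>

definition greedy_program :: com where
  "greedy_program =
     Seq (Assign ''k'' (Const 0))
    (Seq (Assign ''i'' (Const 1))
    (While (Leq (Var ''i'') (Minus (Var ''n'') (Const 1)))
      (Seq
        (Cond (Leq (Plus (Var ''k'') (Const 1))
                   (Plus (Times (Minus (Const 1) (Divide (Const 1) (Var ''alpha''))) (Var ''i''))
                         (Var ''beta'')))
          (Seq (Append (Var ''i'')) (Assign ''k'' (Plus (Var ''k'') (Const 1))))
          Skip)
        (Assign ''i'' (Plus (Var ''i'') (Const 1))))))"

definition input_store :: "nat \<Rightarrow> real \<Rightarrow> real \<Rightarrow> store" where
  "input_store n \<alpha> \<beta> = (\<lambda>_. 0)(''n'' := real n, ''alpha'' := \<alpha>, ''beta'' := \<beta>)"

definition computes_in_time ::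
  "com \<Rightarrow> nat \<Rightarrow> real \<Rightarrow> real \<Rightarrow> nat set set \<Rightarrow> nat \<Rightarrow> bool" where
  "computes_in_time c n \<alpha> \<beta> C t \<longleftrightarrow>
     (\<exists>s' idx. exec c (input_store n \<alpha> \<beta>) [] t s' (map real idx) \<and> distinct idx \<and>
        path_edge ` set idx = C)"

end

theory Submission
  imports Defs
begin

text \<open>
  On the path, a set \<open>C\<close> of edges is a contraction iff every block of \<open>d\<close> consecutive edges contains
  at most \<open>(1 - 1/\<alpha>) * d + \<beta>\<close> edges of \<open>C\<close>. The greedy algorithm looks at the prefixes only: the
  number of edges it selects among the first \<open>i\<close> is the largest integer that is at most \<open>i\<close> and at most
  \<open>(1 - 1/\<alpha>) * i + \<beta>\<close>, which for \<open>i = n - 1\<close> is an upper bound for every contraction. For an inner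
  block, the prefix before it is either selected completely or within \<open>1\<close> of its bound, and
  \<open>\<beta> \<ge> 1\<close> makes up for this rounding error.
\<close>

lemma path_edge_inj: "inj path_edge"
  by (auto simp: inj_def path_edge_def doubleton_eq_iff)

lemma path_edge_eq_iff [simp]: "path_edge i = path_edge j \<longleftrightarrow> i = j"
  using path_edge_inj by (auto dest: injD)

lemma simple_graph_path_graph: "simple_graph (path_graph n)"
  by (auto simp: simple_graph_def path_graph_def path_edge_def)

subsection \<open>Distances in a path\<close>

text \<open>A vertex potential whose differences are the lengths of the subpaths. The index 0, which
  is no edge of \<open>path_graph n\<close>, adds the same amount at every vertex and
  cancels.\<close>

definition potential :: "(nat set \<Rightarrow> real) \<Rightarrow> nat \<Rightarrow> real" where
  "potential w x = (\<Sum>i<x. w (path_edge i))"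

lemma potential_Suc [simp]: "potential w (Suc x) = potential w x + w {x, Suc x}"
  by (simp add: potential_def path_edge_def)

text \<open>Each step changes the potential by at most the weight of its edge, in either direction;
  the triangle inequality sums this up.\<close>

lemma potential_le_path_length:
  "(\<And>e. w e \<ge> 0) \<Longrightarrow> p \<noteq> [] \<Longrightarrow> successively (\<lambda>x y. {x, y} \<in> edges (path_graph n)) p \<Longrightarrow>
    \<bar>potential w (last p) - potential w (hd p)\<bar> \<le> path_length w p"
proof (induction w p rule: path_length.induct)
  case (1 l x y p)
  then obtain i where "{x, y} = {i, Suc i}"
    by (auto simp: path_graph_def path_edge_def)
  then have "\<bar>potential l y - potential l x\<bar> \<le> l {x, y}"
    using 1(2) by (auto simp: doubleton_eq_iff insert_commute)
  with 1 show ?case by auto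
qed auto

lemma path_length_upt: "path_length w [u..<Suc (u + d)] = potential w (u + d) - potential w u"
proof (induction d arbitrary: u)
  case (Suc d)
  have "[u..<Suc (u + Suc d)] = u # Suc u # [Suc (Suc u)..<Suc (Suc u + d)]"
    by (simp add: upt_conv_Cons del: upt_Suc)
  moreover have "[Suc u..<Suc (Suc u + d)] = Suc u # [Suc (Suc u)..<Suc (Suc u + d)]"
    by (simp add: upt_conv_Cons del: upt_Suc)
  ultimately show ?case using Suc[of "Suc u"] by (simp del: upt_Suc)
qed simp

lemma path_length_rev_upt:
  "path_length w (rev [u..<Suc (u + d)]) = potential w (u + d) - potential w u"
  by (induction d) (auto simp: insert_commute)

lemma successively_upt:
  assumes "\<And>i. u \<le> i \<Longrightarrow> Suc i < v \<Longrightarrow> P i (Suc i)"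
  shows "successively P [u..<v]"
  using assms by (auto simp: successively_conv_nth)

lemma upt_in_paths:
  assumes "1 \<le> u" "u \<le> v" "v \<le> n"
  shows "[u..<Suc v] \<in> paths (path_graph n) u v"
    and "rev [u..<Suc v] \<in> paths (path_graph n) v u"
proof -
  have s: "successively (\<lambda>x y. {x, y} \<in> edges (path_graph n)) [u..<Suc v]"
    by (rule successively_upt) (use assms in \<open>auto simp: path_graph_def path_edge_def\<close>)
  have r: "successively (\<lambda>x y. {x, y} \<in> edges (path_graph n)) (rev [u..<Suc v])"
    unfolding successively_rev by (rule successively_mono[OF s]) (metis insert_commute)
  have h: "[u..<Suc v] \<noteq> []" "hd [u..<Suc v] = u" "last [u..<Suc v] = v"
    using assms(2) by (simp_all add: hd_append)
  have v: "set [u..<Suc v] \<subseteq> verts (path_graph n)"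
    using assms by (auto simp: path_graph_def)
  show "[u..<Suc v] \<in> paths (path_graph n) u v"
    unfolding paths_def using s h v by (simp del: upt_Suc)
  show "rev [u..<Suc v] \<in> paths (path_graph n) v u"
    unfolding paths_def using r h v by (simp add: hd_rev last_rev del: upt_Suc)
qed

lemma graph_dist_eqI:
  assumes "p \<in> paths G u v" "\<And>q. q \<in> paths G u v \<Longrightarrow> path_length w p \<le> path_length w q"
  shows "graph_dist G w u v = path_length w p"
  unfolding graph_dist_def using assms by (intro cInf_eq_minimum) auto

text \<open>Every path is at least as long as the potential difference, and the monotone path
  attains it. Both orientations are stated because \<open>is_contraction\<close> ranges over ordered
  pairs.\<close>

lemma graph_dist_path_graph:
  assumes w: "\<And>e. w e \<ge> 0" and uv: "1 \<le> u" "u \<le> v" "v \<le> n"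
  shows "graph_dist (path_graph n) w u v = potential w v - potential w u"
    and "graph_dist (path_graph n) w v u = potential w v - potential w u"
proof -
  have lower: "\<bar>potential w y - potential w x\<bar> \<le> path_length w q"
    if "q \<in> paths (path_graph n) x y" for q x y
    using potential_le_path_length[of w q n] w that by (auto simp: paths_def)
  have len: "path_length w [u..<Suc v] = potential w v - potential w u"
    "path_length w (rev [u..<Suc v]) = potential w v - potential w u"
    using path_length_upt[of w u "v - u"] path_length_rev_upt[of w u "v - u"] uv
    by (simp_all del: upt_Suc)
  show "graph_dist (path_graph n) w u v = potential w v - potential w u"
    unfolding len(1)[symmetric]
  proof (rule graph_dist_eqI[OF upt_in_paths(1)[OF uv]])
    show "path_length w [u..<Suc v] \<le> path_length w q" if "q \<in> paths (path_graph n) u v" for q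
      using lower[OF that] unfolding len by linarith
  qed
  show "graph_dist (path_graph n) w v u = potential w v - potential w u"
    unfolding len(2)[symmetric]
  proof (rule graph_dist_eqI[OF upt_in_paths(2)[OF uv]])
    show "path_length w (rev [u..<Suc v]) \<le> path_length w q" if "q \<in> paths (path_graph n) v u" for q
      using lower[OF that] unfolding len by linarith
  qed
qed

subsection \<open>Contractions of a path\<close>

text \<open>Counts over the indices that \<open>potential\<close> sums over, so that for unit
  lengths contracting \<open>C\<close> lowers the potential at \<open>x\<close> by exactly
  \<open>edge_count C x\<close>.\<close>

definition edge_count :: "nat set set \<Rightarrow> nat \<Rightarrow> nat" where
  "edge_count C x = card {i. i < x \<and> path_edge i \<in> C}"

lemma potential_one: "potential (\<lambda>_. 1) x = real x"
  by (simp add: potential_def)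

lemma potential_zero_on: "potential (zero_on C (\<lambda>_. 1)) x = real x - real (edge_count C x)"
proof -
  have "potential (zero_on C (\<lambda>_. 1)) x = (\<Sum>i<x. 1 - (if path_edge i \<in> C then 1 else 0))"
    unfolding potential_def zero_on_def by (intro sum.cong) auto
  also have "\<dots> = real x - (\<Sum>i<x. if path_edge i \<in> C then 1 else 0)"
    by (simp add: sum_subtractf)
  also have "(\<Sum>i<x. if path_edge i \<in> C then 1 else 0) = real (edge_count C x)"
    by (simp add: edge_count_def sum.If_cases lessThan_def Collect_conj_eq)
  finally show ?thesis .
qed

text \<open>If k of the v - u edges between u and v are contracted, the remaining length v - u - k
  must be at least (v - u) / \<alpha> - \<beta>; solving for k gives the block condition. Symmetry
  of the distance leaves only pairs with u \<le> v.\<close>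

lemma is_contraction_path_graph_iff:
  "is_contraction (path_graph n) (\<lambda>_. 1) (\<lambda>x. x / \<alpha> - \<beta>) C \<longleftrightarrow>
     C \<subseteq> edges (path_graph n) \<and>
     (\<forall>u v. 1 \<le> u \<longrightarrow> u \<le> v \<longrightarrow> v \<le> n \<longrightarrow>
        real (edge_count C v) - real (edge_count C u) \<le> (1 - 1 / \<alpha>) * (real v - real u) + \<beta>)"
    (is "?L \<longleftrightarrow> _ \<and> ?R")
proof -
  let ?G = "path_graph n" and ?z = "zero_on C (\<lambda>_. 1)"
  let ?D = "\<lambda>u v. graph_dist ?G (\<lambda>_. 1) u v / \<alpha> - \<beta> \<le> graph_dist ?G ?z u v"
  have z: "?z e \<ge> 0" for e by (simp add: zero_on_def)
  have V: "verts ?G = {1..n}" by (simp add: path_graph_def)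
  have D: "?D u v \<longleftrightarrow> real (edge_count C v) - real (edge_count C u)
      \<le> (1 - 1 / \<alpha>) * (real v - real u) + \<beta>" "?D v u \<longleftrightarrow> ?D u v"
    if "1 \<le> u" "u \<le> v" "v \<le> n" for u v
    using that by (auto simp: graph_dist_path_graph z potential_one potential_zero_on
        algebra_simps diff_divide_distrib)
  have "(\<forall>u\<in>verts ?G. \<forall>v\<in>verts ?G. paths ?G u v \<noteq> {} \<longrightarrow> ?D u v) \<longleftrightarrow> ?R"
  proof
    assume L: "\<forall>u\<in>verts ?G. \<forall>v\<in>verts ?G. paths ?G u v \<noteq> {} \<longrightarrow> ?D u v"
    show ?R
    proof (intro allI impI)
      fix u v assume uv: "1 \<le> u" "u \<le> v" "v \<le> n"
      then have "u \<in> verts ?G" "v \<in> verts ?G" by (auto simp: V)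
      \<comment> \<open>The monotone path discharges the premise
        \<open>paths ?G u v \<noteq> {}\<close>.\<close>
      then have "?D u v" using L upt_in_paths(1)[OF uv] by blast
      then show "real (edge_count C v) - real (edge_count C u)
        \<le> (1 - 1 / \<alpha>) * (real v - real u) + \<beta>" using D(1)[OF uv] by simp
    qed
  next
    assume R: ?R
    have "?D u v" if "u \<in> {1..n}" "v \<in> {1..n}" for u v
    proof (cases "u \<le> v")
      case True
      then show ?thesis using that R D(1)[of u v] by simp
    next
      case False
      then show ?thesis using that R D[of v u] by simp
    qed
    then show "\<forall>u\<in>verts ?G. \<forall>v\<in>verts ?G. paths ?G u v \<noteq> {} \<longrightarrow> ?D u v" using V by simp
  qed
  then show ?thesis unfolding is_contraction_def by simp
qed

lemma edge_count_total:
  assumes "C \<subseteq> edges (path_graph n)"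
  shows "edge_count C n = card C"
proof -
  have "C = path_edge ` {i. i < n \<and> path_edge i \<in> C}"
    using assms by (auto simp: path_graph_def)
  moreover have "card (path_edge ` {i. i < n \<and> path_edge i \<in> C}) = edge_count C n"
    unfolding edge_count_def by (rule card_image) (simp add: inj_on_def)
  ultimately show ?thesis by simp
qed

section \<open>No loops or parallel edges in a contracted path\<close>

lemma merged_refl: "x \<in> merged C x"
  by (simp add: merged_def)

text \<open>Without edge \<open>i\<close> the path falls apart between \<open>i\<close> and
  \<open>i + 1\<close>: every other edge has both ends on one side, so no chain of edges of
  \<open>C\<close> crosses the cut.\<close>

lemma merged_respects_cut:
  assumes C: "C \<subseteq> range path_edge" and i: "path_edge i \<notin> C" and y: "y \<in> merged C x"
  shows "y \<le> i \<longleftrightarrow> x \<le> i"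
proof -
  have "(x, y) \<in> {(x, y). {x, y} \<in> C}\<^sup>*" using y by (simp add: merged_def)
  then show ?thesis
  proof induction
    case (step y z)
    then obtain j where "{y, z} = path_edge j" "path_edge j \<in> C" using C by fastforce
    with i have "{y, z} = {j, Suc j}" "j \<noteq> i" by (auto simp: path_edge_def)
    then have "z \<le> i \<longleftrightarrow> y \<le> i" by (auto simp: doubleton_eq_iff)
    with step show ?case by simp
  qed simp
qed

text \<open>The cut at an uncontracted edge separates its two ends, so the edge does not become a
  loop.\<close>

lemma merged_path_edge_card:
  assumes "C \<subseteq> range path_edge" "path_edge i \<notin> C"
  shows "card (merged C ` path_edge i) = 2"
proof -
  have "i \<in> merged C i" "i \<notin> merged C (Suc i)"
    using merged_refl merged_respects_cut[OF assms, of i "Suc i"] by auto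
  then have "merged C i \<noteq> merged C (Suc i)" by blast
  then show ?thesis by (simp add: path_edge_def)
qed

text \<open>No parallel edges arise: for \<open>i < j\<close>, the cut at \<open>j\<close> separates
  \<open>Suc j\<close> from both ends of edge \<open>i\<close>, so the class of \<open>Suc j\<close>
  lies in the image of edge \<open>j\<close> but not in that of edge \<open>i\<close>.\<close>

lemma merged_path_edge_inj:
  assumes C: "C \<subseteq> range path_edge"
  shows "inj_on (\<lambda>e. merged C ` e) (range path_edge - C)"
proof -
  have neq: "merged C ` path_edge i \<noteq> merged C ` path_edge j"
    if "i < j" "path_edge j \<notin> C" for i j
  proof
    assume eq: "merged C ` path_edge i = merged C ` path_edge j"
    have "merged C (Suc j) \<in> merged C ` path_edge j" by (simp add: path_edge_def)
    then obtain x where "x \<in> path_edge i" "merged C (Suc j) = merged C x"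
      unfolding eq[symmetric] by blast
    then have "x \<le> i + 1" "Suc j \<in> merged C x"
      using merged_refl[of "Suc j" C] by (auto simp: path_edge_def)
    then show False using merged_respects_cut[OF C that(2), of "Suc j" x] that(1) by simp
  qed
  show ?thesis
  proof (rule inj_onI)
    fix e f assume e: "e \<in> range path_edge - C" and f: "f \<in> range path_edge - C"
      and eq: "merged C ` e = merged C ` f"
    from e f obtain i j where ij: "e = path_edge i" "f = path_edge j" by blast
    with neq[of i j] neq[of j i] e f eq show "e = f"
      by (metis DiffD2 linorder_neqE_nat)
  qed
qed

lemma Phi_path_graph:
  assumes C: "C \<subseteq> edges (path_graph n)"
  shows "Phi (path_graph n) C = card C"
proof -
  let ?E = "edges (path_graph n)"
  have E: "?E \<subseteq> range path_edge" and fin: "finite ?E" by (auto simp: path_graph_def)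
  with C have C': "C \<subseteq> range path_edge" by blast
  have "card (merged C ` e) = 2" if "e \<in> ?E - C" for e
    using merged_path_edge_card[OF C'] E that by blast
  then have "edges (contract (path_graph n) C) = (\<lambda>e. merged C ` e) ` (?E - C)"
    unfolding contract_def by auto
  moreover have "inj_on (\<lambda>e. merged C ` e) (?E - C)"
    using merged_path_edge_inj[OF C'] by (rule inj_on_subset) (use E in auto)
  ultimately have "card (edges (contract (path_graph n) C)) = card (?E - C)"
    by (simp add: card_image)
  also have "\<dots> = card ?E - card C"
    using C fin by (simp add: card_Diff_subset finite_subset)
  \<comment> \<open>Natural subtraction: |E| - (|E| - |C|) = |C| uses |C| \<le> |E|.\<close>
  finally show ?thesis
    using Phi_eq_edge_difference[OF simple_graph_path_graph C] card_mono[OF fin C] by simp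
qed

subsection \<open>The greedy selection\<close>

text \<open>Bridges \<open>greedy\<close> and \<open>greedy_program\<close>: the list is the output
  of the program and its length is |C|. Recursion on the number of edges handled makes the state
  after each prefix available.\<close>

primrec greedy_indices :: "real \<Rightarrow> real \<Rightarrow> nat \<Rightarrow> nat list" where
  "greedy_indices \<alpha> \<beta> 0 = []"
| "greedy_indices \<alpha> \<beta> (Suc i) =
    (if real (length (greedy_indices \<alpha> \<beta> i)) + 1 \<le> (1 - 1 / \<alpha>) * real (Suc i) + \<beta>
     then greedy_indices \<alpha> \<beta> i @ [Suc i] else greedy_indices \<alpha> \<beta> i)"

lemma set_greedy_indices: "set (greedy_indices \<alpha> \<beta> m) \<subseteq> {1..m}"
  by (induction m) auto

lemma distinct_greedy_indices: "distinct (greedy_indices \<alpha> \<beta> m)"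
proof (induction m)
  case (Suc m)
  then show ?case using set_greedy_indices[of \<alpha> \<beta> m] by auto
qed simp

lemma card_path_edge_greedy_indices:
  "card (path_edge ` set (greedy_indices \<alpha> \<beta> m)) = length (greedy_indices \<alpha> \<beta> m)"
  by (simp add: card_image inj_on_def distinct_card distinct_greedy_indices)

lemma greedy_Suc: "greedy (Suc m) \<alpha> \<beta> = path_edge ` set (greedy_indices \<alpha> \<beta> m)"
proof (induction m)
  case (Suc m)
  then show ?case
    by (simp add: greedy_def card_path_edge_greedy_indices)
qed (simp add: greedy_def)

text \<open>Rounds after round \<open>j\<close> append only indices above \<open>j\<close>.\<close>

lemma greedy_indices_prefix:
  "j \<le> m \<Longrightarrow> set (greedy_indices \<alpha> \<beta> m) \<inter> {..j} = set (greedy_indices \<alpha> \<beta> j)"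
proof (induction m)
  case (Suc m)
  show ?case
  proof (cases "j = Suc m")
    case True
    then show ?thesis using set_greedy_indices[of \<alpha> \<beta> "Suc m"] by auto
  next
    case False
    with Suc show ?thesis by auto
  qed
qed simp

text \<open>Exactly the edges 1, ..., a precede vertex \<open>Suc a\<close>; index 0 is never
  selected.\<close>

lemma edge_count_greedy:
  assumes "a \<le> m"
  shows "edge_count (greedy (Suc m) \<alpha> \<beta>) (Suc a) = length (greedy_indices \<alpha> \<beta> a)"
proof -
  have "{i. i < Suc a \<and> path_edge i \<in> greedy (Suc m) \<alpha> \<beta>} = set (greedy_indices \<alpha> \<beta> m) \<inter> {..a}"
    by (auto simp: greedy_Suc)
  also have "\<dots> = set (greedy_indices \<alpha> \<beta> a)" using assms by (rule greedy_indices_prefix)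
  finally show ?thesis
    by (simp add: edge_count_def distinct_card distinct_greedy_indices)
qed

text \<open>An added edge passes the test; a skipped one leaves the count unchanged while the bound
  does not decrease, as 1 - 1/\<alpha> \<ge> 0.\<close>

lemma length_greedy_indices_le:
  assumes "\<alpha> \<ge> 1" "\<beta> \<ge> 1"
  shows "real (length (greedy_indices \<alpha> \<beta> i)) \<le> (1 - 1 / \<alpha>) * real i + \<beta>"
proof (induction i)
  case (Suc i)
  have "(1 - 1 / \<alpha>) * real i \<le> (1 - 1 / \<alpha>) * real (Suc i)"
    using assms by (intro mult_left_mono) auto
  then show ?case using Suc by auto
qed (use assms in simp)

text \<open>A skipped edge fails the test, which gives the second alternative. An added edge raises
  the count by 1 and the bound by at most 1, so either alternative persists.\<close>

lemma greedy_indices_maximal: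
  assumes "\<alpha> \<ge> 1"
  shows "length (greedy_indices \<alpha> \<beta> i) = i \<or>
    real (length (greedy_indices \<alpha> \<beta> i)) > (1 - 1 / \<alpha>) * real i + \<beta> - 1"
proof (induction i)
  case (Suc i)
  have "(1 - 1 / \<alpha>) * real (Suc i) \<le> (1 - 1 / \<alpha>) * real i + 1"
    using assms by (simp add: algebra_simps)
  then show ?case using Suc by auto
qed simp

lemma length_greedy_indices_diff:
  assumes "\<alpha> \<ge> 1" "\<beta> \<ge> 1"
  shows "real (length (greedy_indices \<alpha> \<beta> b)) - real (length (greedy_indices \<alpha> \<beta> a))
    \<le> (1 - 1 / \<alpha>) * (real b - real a) + \<beta>"
proof -
  \<comment> \<open>This settles a completely selected prefix, whose count is \<open>a\<close>;
    otherwise the count misses its bound by less than 1 \<le> \<beta>.\<close>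
  have "(1 - 1 / \<alpha>) * real a \<le> 1 * real a"
    using assms by (intro mult_right_mono) auto
  then show ?thesis
    using greedy_indices_maximal[OF assms(1), of \<beta> a] length_greedy_indices_le[OF assms, of b]
      assms(2)
    by (auto simp: right_diff_distrib)
qed

section \<open>Optimality of the greedy set\<close>

lemma optimal_contraction_greedy:
  assumes n: "n \<ge> 1" and \<alpha>: "\<alpha> \<ge> 1" and \<beta>: "\<beta> \<ge> 1"
  shows "optimal_contraction (path_graph n) (\<lambda>_. 1) (\<lambda>x. x / \<alpha> - \<beta>) (greedy n \<alpha> \<beta>)"
proof -
  from n obtain m where m: "n = Suc m" by (cases n) auto
  let ?C = "greedy n \<alpha> \<beta>"
  have sub: "?C \<subseteq> edges (path_graph n)"
    using image_mono[OF set_greedy_indices, of path_edge \<alpha> \<beta> m]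
    by (simp add: m greedy_Suc path_graph_def atLeastLessThanSuc_atLeastAtMost)
  have "real (edge_count ?C v) - real (edge_count ?C u) \<le> (1 - 1 / \<alpha>) * (real v - real u) + \<beta>"
    if "1 \<le> u" "u \<le> v" "v \<le> n" for u v
  proof -
    have "u = Suc (u - 1)" "v = Suc (v - 1)" using that by simp_all
    then obtain a b where "u = Suc a" "v = Suc b" by blast
    moreover from this have "a \<le> m" "b \<le> m" using that m by simp_all
    ultimately show ?thesis
      using length_greedy_indices_diff[OF \<alpha> \<beta>, of b a] by (simp add: m edge_count_greedy)
  qed
  then have contr: "is_contraction (path_graph n) (\<lambda>_. 1) (\<lambda>x. x / \<alpha> - \<beta>) ?C"
    using sub by (simp add: is_contraction_path_graph_iff)
  have "Phi (path_graph n) C \<le> Phi (path_graph n) ?C"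
    if C: "is_contraction (path_graph n) (\<lambda>_. 1) (\<lambda>x. x / \<alpha> - \<beta>) C" for C
  proof -
    \<comment> \<open>The block from vertex 1 to vertex n is the whole path and bounds |C|
      itself.\<close>
    from C have CE: "C \<subseteq> edges (path_graph n)"
      and "real (edge_count C n) - real (edge_count C 1) \<le> (1 - 1 / \<alpha>) * (real n - real 1) + \<beta>"
      using n unfolding is_contraction_path_graph_iff by blast+
    moreover have "path_edge 0 \<notin> C"
      using CE by (auto simp: path_graph_def)
    then have "edge_count C 1 = 0"
      by (auto simp: edge_count_def less_Suc_eq)
    ultimately have up: "real (card C) \<le> (1 - 1 / \<alpha>) * real m + \<beta>"
      by (simp add: edge_count_total m)
    have "finite (edges (path_graph n))" by (simp add: path_graph_def)
    from card_mono[OF this CE] have "card C \<le> m"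
      by (simp add: path_graph_def m card_image inj_on_def)
    \<comment> \<open>If not all m edges are selected, the greedy size exceeds the bound minus 1,
      hence by integrality is at least |C|.\<close>
    then have "card C \<le> length (greedy_indices \<alpha> \<beta> m)"
      using greedy_indices_maximal[OF \<alpha>, of \<beta> m] up by linarith
    then show ?thesis
      using CE sub by (simp add: Phi_path_graph m greedy_Suc card_path_edge_greedy_indices)
  qed
  with contr show ?thesis unfolding optimal_contraction_def by blast
qed

subsection \<open>Running time\<close>

definition greedy_body :: com where
  "greedy_body = Seq
    (Cond (Leq (Plus (Var ''k'') (Const 1))
               (Plus (Times (Minus (Const 1) (Divide (Const 1) (Var ''alpha''))) (Var ''i''))
                     (Var ''beta'')))
      (Seq (Append (Var ''i'')) (Assign ''k'' (Plus (Var ''k'') (Const 1))))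
      Skip)
    (Assign ''i'' (Plus (Var ''i'') (Const 1)))"

definition greedy_guard :: bexp where
  "greedy_guard = Leq (Var ''i'') (Minus (Var ''n'') (Const 1))"

text \<open>Loop invariant after \<open>i\<close> rounds; the variable \<open>''i''\<close> already
  holds the next index. The output is an argument of \<open>exec\<close> and is tracked
  there.\<close>

definition greedy_state :: "nat \<Rightarrow> real \<Rightarrow> real \<Rightarrow> nat \<Rightarrow> store \<Rightarrow> bool" where
  "greedy_state n \<alpha> \<beta> i s \<longleftrightarrow> s ''n'' = real n \<and> s ''alpha'' = \<alpha> \<and> s ''beta'' = \<beta> \<and>
     s ''i'' = real (Suc i) \<and> s ''k'' = real (length (greedy_indices \<alpha> \<beta> i))"

text \<open>A round costs 24 steps if the edge is added and 19 otherwise; 30 is a rounded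
  bound.\<close>

lemma exec_greedy_body:
  assumes s: "greedy_state n \<alpha> \<beta> i s"
  shows "\<exists>t s'. exec greedy_body s (map real (greedy_indices \<alpha> \<beta> i)) t s'
      (map real (greedy_indices \<alpha> \<beta> (Suc i))) \<and> t \<le> 30 \<and> greedy_state n \<alpha> \<beta> (Suc i) s'"
proof (cases "real (length (greedy_indices \<alpha> \<beta> i)) + 1 \<le> (1 - 1 / \<alpha>) * real (Suc i) + \<beta>")
  case True
  \<comment> \<open>Time and final store stay schematic until the execution rules determine
    them.\<close>
  show ?thesis
    unfolding greedy_body_def
    by (intro exI conjI, rule exec.Seq, rule exec.CondTrue)
      (use s True in \<open>auto simp: greedy_state_def intro: exec.intros\<close>)
next
  case False
  show ?thesis
    unfolding greedy_body_def
    by (intro exI conjI, rule exec.Seq, rule exec.CondFalse)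
      (use s False in \<open>auto simp: greedy_state_def intro: exec.intros\<close>)
qed

text \<open>Induction on the number of remaining rounds. Each loop test costs 6, so a round takes at
  most 36 \<le> 40 steps and the exit 6 \<le> 10.\<close>

lemma exec_greedy_loop:
  assumes "greedy_state (Suc m) \<alpha> \<beta> i s" "i \<le> m"
  shows "\<exists>t s'. exec (While greedy_guard greedy_body) s (map real (greedy_indices \<alpha> \<beta> i)) t s'
      (map real (greedy_indices \<alpha> \<beta> m)) \<and> t \<le> 40 * (m - i) + 10"
  using assms
proof (induction "m - i" arbitrary: i s)
  case 0
  \<comment> \<open>Here \<open>''i''\<close> holds \<open>m + 1 = n\<close>, which exceeds
    \<open>n - 1\<close>.\<close>
  then have "i = m" "\<not> bval greedy_guard s"
    by (auto simp: greedy_state_def greedy_guard_def)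
  then show ?case
    using exec.WhileFalse[of greedy_guard s greedy_body "map real (greedy_indices \<alpha> \<beta> m)"]
    by (intro exI[of _ "1 + bcost greedy_guard"] exI[of _ s]) (simp add: greedy_guard_def)
next
  case (Suc d)
  then have i: "Suc i \<le> m" and g: "bval greedy_guard s"
    by (auto simp: greedy_state_def greedy_guard_def)
  obtain t1 s1 where 1: "exec greedy_body s (map real (greedy_indices \<alpha> \<beta> i)) t1 s1
      (map real (greedy_indices \<alpha> \<beta> (Suc i)))" "t1 \<le> 30" "greedy_state (Suc m) \<alpha> \<beta> (Suc i) s1"
    using exec_greedy_body[OF Suc.prems(1)] by blast
  obtain t2 s2 where 2: "exec (While greedy_guard greedy_body) s1
      (map real (greedy_indices \<alpha> \<beta> (Suc i))) t2 s2 (map real (greedy_indices \<alpha> \<beta> m))"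
    "t2 \<le> 40 * (m - Suc i) + 10"
    using Suc.hyps(1)[OF _ 1(3) i] Suc.hyps(2) by fastforce
  have "1 + bcost greedy_guard + t1 + t2 \<le> 40 * (m - i) + 10"
    using 1(2) 2(2) i by (simp add: greedy_guard_def)
  then show ?case using exec.WhileTrue[OF g 1(1) 2(1)] by blast
qed

lemma greedy_program_time:
  assumes n: "n \<ge> 1"
  shows "\<exists>t. computes_in_time greedy_program n \<alpha> \<beta> (greedy n \<alpha> \<beta>) t \<and> t \<le> 40 * n"
proof -
  from n obtain m where m: "n = Suc m" by (cases n) auto
  let ?s = "(input_store n \<alpha> \<beta>)(''k'' := 0, ''i'' := 1)"
  have "greedy_state (Suc m) \<alpha> \<beta> 0 ?s" by (simp add: greedy_state_def input_store_def m)
  from exec_greedy_loop[OF this] obtain t s' where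
    loop: "exec (While greedy_guard greedy_body) ?s [] t s' (map real (greedy_indices \<alpha> \<beta> m))"
    and t: "t \<le> 40 * m + 10" by auto
  have p: "greedy_program = Seq (Assign ''k'' (Const 0)) (Seq (Assign ''i'' (Const 1))
      (While greedy_guard greedy_body))"
    by (simp add: greedy_program_def greedy_guard_def greedy_body_def)
  have "exec greedy_program (input_store n \<alpha> \<beta>) [] (2 + (2 + t)) s'
      (map real (greedy_indices \<alpha> \<beta> m))"
    unfolding p
    using exec.Seq[OF exec.Assign[of "''k''" "Const 0" "input_store n \<alpha> \<beta>"]
        exec.Seq[OF exec.Assign[of "''i''" "Const 1"]]] loop by simp
  then have "computes_in_time greedy_program n \<alpha> \<beta> (greedy n \<alpha> \<beta>) (2 + (2 + t))"
    unfolding computes_in_time_def m greedy_Suc using distinct_greedy_indices by blast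
  \<comment> \<open>The two initial assignments cost 2 each, and 40 * m + 14 \<le> 40 * (m +
    1).\<close>
  moreover have "2 + (2 + t) \<le> 40 * n" using t m by simp
  ultimately show ?thesis by blast
qed

theorem theorem2:
  "(\<forall>(n::nat) (\<alpha>::real) (\<beta>::real). n \<ge> 1 \<longrightarrow> \<alpha> \<ge> 1 \<longrightarrow> \<beta> \<ge> 1 \<longrightarrow>
      optimal_contraction (path_graph n) (\<lambda>_. 1) (\<lambda>x. x / \<alpha> - \<beta>) (greedy n \<alpha> \<beta>)) \<and>
   (\<exists>c::nat. \<forall>(n::nat) (\<alpha>::real) (\<beta>::real). n \<ge> 1 \<longrightarrow> \<alpha> \<ge> 1 \<longrightarrow> \<beta> \<ge> 1 \<longrightarrow>
      (\<exists>t. computes_in_time greedy_program n \<alpha> \<beta> (greedy n \<alpha> \<beta>) t \<and> t \<le> c * n))"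
  using optimal_contraction_greedy greedy_program_time by blast

end
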